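(* For a complete graph $\mathbb{K}_n,$ $S(\mathbb{K}_n)$ is compliant and $d_{td}(a)=\left\lceil\frac{3n}{2}\right\rceil-1,$ for every vertex in $S(\mathbb{K}_n).$
   Context: $S(\mathbb{G})$ denotes the subdivision of $\mathbb{G}$, obtained by replacing each edge by a path of length two. A total dominating set (TDS) is a vertex set $S$ such that every vertex is adjacent to a vertex of $S$; a minimal TDS (MTDS) has no proper subset that is a TDS. A vertex is compliant if some MTDS contains it; a graph is compliant if all its vertices are. For a vertex $a$ of a compliant graph, $d_{td}(a)=\min\{|S| : S \text{ an MTDS containing } a\}$. *)

theory Defs
  imports Complex_Main
begin

record 'a ugraph =
  verts :: "'a set"
  edges :: "'a set set"

definition simple_graph :: "'a ugraph \<Rightarrow> bool" where
  "simple_graph G \<longleftrightarrow>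
     finite (verts G) \<and> (\<forall>e\<in>edges G. e \<subseteq> verts G \<and> card e = 2)"

definition adjacent :: "'a ugraph \<Rightarrow> 'a \<Rightarrow> 'a \<Rightarrow> bool" where
  "adjacent G u v \<longleftrightarrow> {u, v} \<in> edges G"

definition complete_graph :: "nat \<Rightarrow> 'a ugraph \<Rightarrow> bool" where
  "complete_graph n G \<longleftrightarrow>
     simple_graph G \<and> card (verts G) = n \<and>
     (\<forall>u\<in>verts G. \<forall>v\<in>verts G. u \<noteq> v \<longrightarrow> adjacent G u v)"

(* An edge e = {u, v} of G becomes the path Inl u, Inr e, Inl v: the new middle vertex
   is the edge e itself, and the edge {u, v} is not kept. *)
definition subdivision :: "'a ugraph \<Rightarrow> ('a + 'a set) ugraph" where
  "subdivision G =
     \<lparr> verts = verts G <+> edges G,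
       edges = {{Inl v, Inr e} | v e. e \<in> edges G \<and> v \<in> e} \<rparr>"

definition total_dominating_set :: "'a ugraph \<Rightarrow> 'a set \<Rightarrow> bool" where
  "total_dominating_set G S \<longleftrightarrow>
     S \<subseteq> verts G \<and> (\<forall>v\<in>verts G. \<exists>u\<in>S. adjacent G v u)"

definition minimal_total_dominating_set :: "'a ugraph \<Rightarrow> 'a set \<Rightarrow> bool" where
  "minimal_total_dominating_set G S \<longleftrightarrow>
     total_dominating_set G S \<and> (\<forall>T. T \<subset> S \<longrightarrow> \<not> total_dominating_set G T)"

definition compliant_vertex :: "'a ugraph \<Rightarrow> 'a \<Rightarrow> bool" where
  "compliant_vertex G a \<longleftrightarrow> (\<exists>S. minimal_total_dominating_set G S \<and> a \<in> S)"

definition compliant_graph :: "'a ugraph \<Rightarrow> bool" where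
  "compliant_graph G \<longleftrightarrow> (\<forall>a\<in>verts G. compliant_vertex G a)"

(* Meaningful only for a compliant vertex a of a finite graph: otherwise Min is applied to
   an empty (or possibly infinite) set, and its value is unspecified. *)
definition d_td :: "'a ugraph \<Rightarrow> 'a \<Rightarrow> nat" where
  "d_td G a = Min {card S | S. minimal_total_dominating_set G S \<and> a \<in> S}"

lemma simple_graph_subdivision:
  assumes "simple_graph G"
  shows "simple_graph (subdivision G)"
proof -
  have "edges G \<subseteq> Pow (verts G)" "finite (verts G)"
    using assms by (auto simp: simple_graph_def)
  then have "finite (edges G)"
    by (meson finite_Pow_iff finite_subset)
  then show ?thesis
    using assms by (auto simp: simple_graph_def subdivision_def)
qed

end

theory Submission
  imports Defs
begin

text \<open>
  A total dominating set of \<open>S(G)\<close> is the disjoint union of a vertex cover of \<open>G\<close> (which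
  dominates the middle vertices) and an edge cover of \<open>G\<close> (which dominates the original
  vertices). For \<open>K\<^sub>n\<close> these have at least \<open>n - 1\<close> and \<open>\<lceil>n / 2\<rceil>\<close> elements, and every vertex of
  \<open>S(K\<^sub>n)\<close> lies in a total dominating set attaining both bounds; such a set is minimal because
  it has minimum cardinality.
\<close>

section \<open>Covers of a graph and total domination in its subdivision\<close>

definition vertex_cover :: "'a ugraph \<Rightarrow> 'a set \<Rightarrow> bool" where
  "vertex_cover G A \<longleftrightarrow> A \<subseteq> verts G \<and> (\<forall>e\<in>edges G. e \<inter> A \<noteq> {})"

definition edge_cover :: "'a ugraph \<Rightarrow> 'a set set \<Rightarrow> bool" where
  "edge_cover G F \<longleftrightarrow> F \<subseteq> edges G \<and> verts G \<subseteq> \<Union>F"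

lemma adjacent_subdivision [simp]:
  "adjacent (subdivision G) (Inl v) (Inr e) \<longleftrightarrow> e \<in> edges G \<and> v \<in> e"
  "adjacent (subdivision G) (Inr e) (Inl v) \<longleftrightarrow> e \<in> edges G \<and> v \<in> e"
  "\<not> adjacent (subdivision G) (Inl v) (Inl w)"
  "\<not> adjacent (subdivision G) (Inr e) (Inr f)"
  by (auto simp: adjacent_def subdivision_def doubleton_eq_iff)

lemma verts_subdivision [simp]: "verts (subdivision G) = verts G <+> edges G"
  by (simp add: subdivision_def)

text \<open>Edges of the subdivision only join an \<open>Inl\<close> to an \<open>Inr\<close>, so
  the two requirements decouple: each side can be dominated only from the other.\<close>

lemma total_dominating_set_subdivision:
  "total_dominating_set (subdivision G) (A <+> F) \<longleftrightarrow> vertex_cover G A \<and> edge_cover G F"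
proof -
  have sub: "A <+> F \<subseteq> verts G <+> edges G \<longleftrightarrow> A \<subseteq> verts G \<and> F \<subseteq> edges G"
    by auto
  have "(\<forall>x\<in>verts G <+> edges G. \<exists>y\<in>A <+> F. adjacent (subdivision G) x y) \<longleftrightarrow>
      (\<forall>v\<in>verts G. \<exists>e\<in>F. e \<in> edges G \<and> v \<in> e) \<and> (\<forall>e\<in>edges G. \<exists>v\<in>A. v \<in> e)"
    by (simp add: Plus_def ball_Un bex_Un)
  moreover have "(\<forall>e\<in>edges G. \<exists>v\<in>A. v \<in> e) \<longleftrightarrow> (\<forall>e\<in>edges G. e \<inter> A \<noteq> {})"
    by (simp add: disjoint_iff) metis
  \<comment> \<open>The conjunct \<open>e \<in> edges G\<close> comes from adjacency. Dropping it
    requires \<open>F \<subseteq> edges G\<close>, which either side of the goal supplies.\<close>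
  moreover have "(\<forall>v\<in>verts G. \<exists>e\<in>F. e \<in> edges G \<and> v \<in> e) \<longleftrightarrow> verts G \<subseteq> \<Union>F"
    if "F \<subseteq> edges G"
    using that by (simp add: subset_iff) metis
  ultimately show ?thesis
    unfolding total_dominating_set_def vertex_cover_def edge_cover_def verts_subdivision sub
    by argo
qed

section \<open>Lower bounds for covers\<close>

lemma simple_graph_finite_edges:
  assumes "simple_graph G"
  shows "finite (edges G)"
proof (rule finite_subset)
  show "edges G \<subseteq> Pow (verts G)" "finite (Pow (verts G))"
    using assms by (auto simp: simple_graph_def)
qed

text \<open>Each edge covers only two vertices, so \<open>2 * card F\<close> is at least the order
  of \<open>G\<close>; the \<open>+ 1\<close> rounds the half upwards.\<close>

lemma edge_cover_card_ge:
  assumes "simple_graph G" "edge_cover G F"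
  shows "(card (verts G) + 1) div 2 \<le> card F"
proof -
  have F: "F \<subseteq> edges G" "verts G \<subseteq> \<Union>F"
    using assms(2) by (auto simp: edge_cover_def)
  have two: "card e = 2" if "e \<in> F" for e
    using assms(1) F(1) that by (auto simp: simple_graph_def)
  have finF: "finite F"
    using F(1) simple_graph_finite_edges[OF assms(1)] finite_subset by blast
  have "finite e" if "e \<in> F" for e
    using two[OF that] by (intro card_ge_0_finite) simp
  then have "finite (\<Union>F)"
    using finF by (rule finite_Union[rotated])
  then have "card (verts G) \<le> card (\<Union>F)"
    using F(2) by (simp add: card_mono)
  also have "\<dots> \<le> sum card F"
    by (rule card_Union_le_sum_card)
  also have "\<dots> = 2 * card F"
    using two by simp
  finally show ?thesis by linarith
qed

text \<open>Two distinct vertices outside \<open>A\<close> would span an edge that \<open>A\<close>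
  misses, so at most one vertex is left out.\<close>

lemma complete_graph_vertex_cover_card_ge:
  assumes "complete_graph n G" "vertex_cover G A"
  shows "n - 1 \<le> card A"
proof -
  have fin: "finite (verts G)" and n: "card (verts G) = n"
    using assms(1) by (auto simp: complete_graph_def simple_graph_def)
  have "u = v" if "u \<in> verts G - A" "v \<in> verts G - A" for u v
  proof (rule ccontr)
    assume "u \<noteq> v"
    then have "{u, v} \<in> edges G"
      using assms(1) that by (auto simp: complete_graph_def adjacent_def)
    then have "{u, v} \<inter> A \<noteq> {}"
      using assms(2) unfolding vertex_cover_def by blast
    then show False
      using that by simp
  qed
  then have "card (verts G - A) \<le> Suc 0"
    using card_le_Suc0_iff_eq[of "verts G - A"] fin by blast
  moreover have "A \<subseteq> verts G"
    using assms(2) by (simp add: vertex_cover_def)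
  ultimately show ?thesis
    using fin n by (simp add: card_Diff_subset finite_subset)
qed

section \<open>Optimal covers of a complete graph\<close>

lemma complete_graph_edge_iff:
  assumes "complete_graph n G"
  shows "e \<in> edges G \<longleftrightarrow> e \<subseteq> verts G \<and> card e = 2"
  using assms by (auto simp: complete_graph_def simple_graph_def adjacent_def card_2_iff)

lemma complete_graph_vertex_cover_remove:
  assumes "complete_graph n G" "w \<in> verts G"
  shows "vertex_cover G (verts G - {w})" "card (verts G - {w}) = n - 1"
proof -
  show "vertex_cover G (verts G - {w})"
    unfolding vertex_cover_def
  proof (intro conjI ballI)
    fix e assume "e \<in> edges G"
    then have "e \<subseteq> verts G" "card e = 2"
      using complete_graph_edge_iff[OF assms(1)] by auto
    then show "e \<inter> (verts G - {w}) \<noteq> {}"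
      by (auto simp: card_2_iff)
  qed auto
  show "card (verts G - {w}) = n - 1"
    using assms by (auto simp: complete_graph_def)
qed

text \<open>Split off the prescribed pair \<open>e\<close> and recurse on \<open>V - e\<close> with
  an arbitrary pair there. Sizes 2 and 3 are the base cases, since then \<open>V - e\<close>
  contains no pair. Prescribing \<open>e\<close> later allows any given middle vertex to be
  included.\<close>

lemma pair_cover_exists:
  assumes "finite V" "e \<subseteq> V" "card e = 2"
  shows "\<exists>F. e \<in> F \<and> (\<forall>f\<in>F. f \<subseteq> V \<and> card f = 2) \<and> V \<subseteq> \<Union>F \<and> card F = (card V + 1) div 2"
  using assms
proof (induction "card V" arbitrary: V e rule: less_induct)
  case less
  have cV: "card (V - e) = card V - 2" and ge: "card V \<ge> 2"
    using less.prems card_mono[of V e] by (auto simp: card_Diff_subset finite_subset)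
  consider "card V = 2" | "card V = 3" | "card V \<ge> 4" using ge by linarith
  then show ?case
  proof cases
    case 1
    then have "V = e"
      using less.prems card_subset_eq[of V e] by simp
    then show ?thesis
      using less.prems by (intro exI[of _ "{e}"]) auto
  next
    case 2
    then obtain w where w: "V - e = {w}"
      using cV by (auto simp: card_1_singleton_iff numeral_eq_Suc)
    obtain u v where uv: "e = {u, v}" "u \<noteq> v"
      using less.prems by (auto simp: card_2_iff)
    have "w \<noteq> u" "w \<noteq> v" "V = {u, v, w}"
      using w uv less.prems by auto
    \<comment> \<open>The leftover point \<open>w\<close> reuses the already covered
      \<open>u\<close>; this overlap accounts for the rounding up when \<open>card V\<close> is
      odd.\<close>
    then show ?thesis
      using uv by (intro exI[of _ "{e, {u, w}}"]) (auto simp: doubleton_eq_iff)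
  next
    case 3
    then have "2 \<le> card (V - e)"
      using cV by simp
    then obtain f where f: "f \<subseteq> V - e" "card f = 2"
      by (rule obtain_subset_with_card_n)
    obtain F where F: "f \<in> F" "\<forall>g\<in>F. g \<subseteq> V - e \<and> card g = 2" "V - e \<subseteq> \<Union>F"
        "card F = (card (V - e) + 1) div 2"
    proof -
      have "card (V - e) < card V" "finite (V - e)"
        using less.prems(1) cV ge by simp_all
      then show thesis
        using less.hyps[of "V - e" f] f that by blast
    qed
    \<comment> \<open>Infinite sets have \<open>card\<close> 0, so a positive cardinality gives
      finiteness.\<close>
    have "finite F"
      using F(4) cV 3 by (intro card_ge_0_finite) simp
    moreover have "e \<notin> F"
    proof
      assume "e \<in> F"
      \<comment> \<open>Members of \<open>F\<close> lie in \<open>V - e\<close>, so \<open>e\<close>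
        would be disjoint from itself.\<close>
      then have "e = {}"
        using F(2) by blast
      then show False
        using less.prems(3) by simp
    qed
    ultimately have card: "card (insert e F) = (card V + 1) div 2"
      using F(4) cV 3 by simp
    have pairs: "\<forall>g\<in>insert e F. g \<subseteq> V \<and> card g = 2"
      using F(2) less.prems by blast
    have "V \<subseteq> \<Union>(insert e F)"
      using F(3) by auto
    then show ?thesis
      using card pairs by blast
  qed
qed

lemma complete_graph_edge_cover_exists:
  assumes "complete_graph n G" "e \<in> edges G"
  shows "\<exists>F. edge_cover G F \<and> e \<in> F \<and> card F = (n + 1) div 2"
proof -
  have "finite (verts G)" "card (verts G) = n"
    using assms(1) by (auto simp: complete_graph_def simple_graph_def)
  then obtain F where "e \<in> F" "\<forall>f\<in>F. f \<subseteq> verts G \<and> card f = 2" "verts G \<subseteq> \<Union>F"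
      "card F = (n + 1) div 2"
    using pair_cover_exists[of "verts G" e] assms complete_graph_edge_iff[OF assms(1)] by auto
  moreover from this have "edge_cover G F"
    using complete_graph_edge_iff[OF assms(1)] unfolding edge_cover_def by blast
  ultimately show ?thesis by blast
qed

section \<open>Minimum total dominating sets through a given vertex\<close>

lemma complete_graph_total_dominating_set_card_ge:
  assumes "complete_graph n G" "total_dominating_set (subdivision G) S"
  shows "n - 1 + (n + 1) div 2 \<le> card S"
proof -
  have G: "simple_graph G" "finite (verts G)" "card (verts G) = n"
    using assms(1) by (auto simp: complete_graph_def simple_graph_def)
  define A F where "A = Inl -` S" and "F = Inr -` S"
  have S: "S = A <+> F"
  proof (rule set_eqI)
    fix x show "x \<in> S \<longleftrightarrow> x \<in> A <+> F"
      by (cases x) (auto simp: A_def F_def)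
  qed
  then have cov: "vertex_cover G A" "edge_cover G F"
    using assms(2) by (auto simp: total_dominating_set_subdivision)
  then have "finite A" "finite F"
    using G simple_graph_finite_edges[of G]
    by (auto simp: vertex_cover_def edge_cover_def intro: finite_subset)
  then have "card S = card A + card F"
    by (simp add: S card_Plus)
  then show ?thesis
    using complete_graph_vertex_cover_card_ge[OF assms(1) cov(1)]
      edge_cover_card_ge[OF G(1) cov(2)] G(3) by simp
qed

text \<open>Combine all vertices but one with a smallest edge cover, choosing the omitted vertex
  \<open>w\<close> and the prescribed edge \<open>e\<close> according to \<open>a\<close>.\<close>

lemma complete_graph_minimum_set_exists:
  assumes "n \<ge> 2" "complete_graph n G" "a \<in> verts (subdivision G)"
  shows "\<exists>S. minimal_total_dominating_set (subdivision G) S \<and> a \<in> S \<and>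
    card S = n - 1 + (n + 1) div 2"
proof -
  have G: "simple_graph G" "finite (verts G)" "card (verts G) = n"
    using assms(2) by (auto simp: complete_graph_def simple_graph_def)
  obtain w where w: "w \<in> verts G" "a \<noteq> Inl w"
  proof -
    \<comment> \<open>For \<open>a = Inr f\<close> the value \<open>projl a\<close> is unspecified,
      but then every \<open>w\<close> differs from \<open>a\<close> in the required sense.\<close>
    have "\<not> verts G \<subseteq> {projl a}"
      using G assms(1) card_mono[of "{projl a}" "verts G"] by auto
    then show thesis
      using that by (metis insertCI subsetI sum.sel(1))
  qed
  \<comment> \<open>The condition forces \<open>e = f\<close> if \<open>a = Inr f\<close>, and is
    vacuous if \<open>a\<close> is an original vertex.\<close>
  obtain e where e: "e \<in> edges G" "\<And>f. a = Inr f \<Longrightarrow> f = e"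
  proof (cases a)
    case (Inl v)
    have "2 \<le> card (verts G)"
      using G assms(1) by simp
    then obtain f where "f \<subseteq> verts G" "card f = 2"
      by (rule obtain_subset_with_card_n)
    then show thesis
      using that Inl complete_graph_edge_iff[OF assms(2)] by auto
  next
    case (Inr f)
    then show thesis
      using that assms(3) by auto
  qed
  obtain F where F: "edge_cover G F" "e \<in> F" "card F = (n + 1) div 2"
    using complete_graph_edge_cover_exists[OF assms(2) e(1)] by auto
  define S where "S = (verts G - {w}) <+> F"
  have "finite F"
    using F(3) assms(1) by (intro card_ge_0_finite) simp
  then have card: "card S = n - 1 + (n + 1) div 2" and fin: "finite S"
    using G complete_graph_vertex_cover_remove[OF assms(2) w(1)] F(3)
    by (simp_all add: S_def card_Plus)
  have "total_dominating_set (subdivision G) S"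
    using complete_graph_vertex_cover_remove[OF assms(2) w(1)] F(1)
    by (simp add: S_def total_dominating_set_subdivision)
  \<comment> \<open>A proper subset of the finite set \<open>S\<close> has fewer elements than the
    lower bound permits.\<close>
  moreover have "\<not> total_dominating_set (subdivision G) T" if "T \<subset> S" for T
    using complete_graph_total_dominating_set_card_ge[OF assms(2), of T] card
      psubset_card_mono[OF fin that] by auto
  moreover have "a \<in> S"
    using assms(3) w(2) e(2) F(2) by (auto simp: S_def)
  ultimately show ?thesis
    using card by (auto simp: minimal_total_dominating_set_def)
qed

text \<open>The bound on \<open>n\<close> excludes the one-vertex graph, whose subdivision is an
  isolated vertex without any total dominating set.\<close>

theorem theorem13:
  fixes n :: nat and G :: "'a ugraph"
  assumes "n \<ge> 2" and "complete_graph n G"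
  shows "compliant_graph (subdivision G) \<and>
         (\<forall>a\<in>verts (subdivision G). int (d_td (subdivision G) a) = \<lceil>3 * real n / 2\<rceil> - 1)"
proof (intro conjI ballI)
  show "compliant_graph (subdivision G)"
    using complete_graph_minimum_set_exists[OF assms]
    unfolding compliant_graph_def compliant_vertex_def by blast
next
  fix a assume a: "a \<in> verts (subdivision G)"
  let ?H = "subdivision G"
  let ?M = "{card S | S. minimal_total_dominating_set ?H S \<and> a \<in> S}"
  have "simple_graph ?H"
    using assms(2) by (intro simple_graph_subdivision) (simp add: complete_graph_def)
  \<comment> \<open>\<open>Min\<close> is determined only on finite nonempty sets, so finiteness of
    \<open>?M\<close> comes first.\<close>
  then have "finite (card ` Pow (verts ?H))"
    unfolding simple_graph_def by blast
  moreover have "?M \<subseteq> card ` Pow (verts ?H)"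
    unfolding minimal_total_dominating_set_def total_dominating_set_def by blast
  ultimately have "finite ?M"
    by (rule rev_finite_subset)
  then have "Min ?M = n - 1 + (n + 1) div 2"
  proof (rule Min_eqI)
    show "n - 1 + (n + 1) div 2 \<le> k" if "k \<in> ?M" for k
      using that complete_graph_total_dominating_set_card_ge[OF assms(2)]
      unfolding minimal_total_dominating_set_def by blast
    show "n - 1 + (n + 1) div 2 \<in> ?M"
      using complete_graph_minimum_set_exists[OF assms a] by force
  qed
  \<comment> \<open>Splitting by parity makes both the ceiling and \<open>div\<close>
    explicit.\<close>
  moreover have "\<lceil>3 * real n / 2\<rceil> = int (n + (n + 1) div 2)"
  proof (cases "even n")
    case True
    then obtain k where "n = 2 * k" by auto
    then show ?thesis by (simp add: ceiling_eq_iff)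
  next
    case False
    then obtain k where "n = 2 * k + 1" by (rule oddE)
    then show ?thesis by (simp add: ceiling_eq_iff)
  qed
  \<comment> \<open>Since \<open>n\<close> is positive, the truncated \<open>n - 1\<close> agrees
    with integer subtraction.\<close>
  ultimately show "int (d_td ?H a) = \<lceil>3 * real n / 2\<rceil> - 1"
    using assms(1) by (simp add: d_td_def)
qed

end
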